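(* Let $(L,\alpha)$ be a Hom-Lie algebra with $\alpha$ invertible over an algebraically closed field $\mathbb F$, and let $k,s$ be integers. If $(L,\alpha)$ is simple and finite-dimensional, and $f:(L,\mathrm{ad}_k,\alpha)\to(L,\mathrm{ad}_{k+s},\alpha)$ is a homomorphism of $(L,\alpha)$-modules, then $f=\lambda\alpha^{s+1}$ for some $\lambda\in\mathbb F$.
   Context: All vector spaces are over a fixed field $\mathbb F$ with $\mathrm{char}(\mathbb F)\neq 2$. A (multiplicative) Hom-Lie algebra $(L,\alpha)$ is a vector space $L$ with a bilinear bracket $[-,-]:L\times L\to L$ and a linear map $\alpha:L\to L$ such that $[x,y]=-[y,x]$, $[\alpha(x),[y,z]]+[\alpha(y),[z,x]]+[\alpha(z),[x,y]]=0$ and $\alpha([x,y])=[\alpha(x),\alpha(y)]$ for all $x,y,z\in L$. An ideal is a subspace $I$ with $[I,L]\subseteq I$ and $\alpha(I)\subseteq I$; $(L,\alpha)$ is simple if it is not abelian and has no ideals other than $\{0\}$ and $L$. An $(L,\alpha)$-module $(V,\rho,\beta)$ is a vector space $V$ with a linear map $\rho:L\to\mathrm{End}(V)$ and $\beta\in\mathrm{End}(V)$ such that for all $x,y\in L$: $\beta\rho(x)=\rho(\alpha(x))\beta$ and $\rho([x,y])\beta=\rho(\alpha(x))\rho(y)-\rho(\alpha(y))\rho(x)$. For an integer $k$, the $\alpha^k$-adjoint module $(L,\mathrm{ad}_k,\alpha)$ is given by $\mathrm{ad}_k(x)(y)=[\alpha^k(x),y]$. A homomorphism of $(L,\alpha)$-modules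 $f:(V_1,\rho_1,\beta_1)\to(V_2,\rho_2,\beta_2)$ is a linear map $f:V_1\to V_2$ such that $\beta_2\circ f=f\circ\beta_1$ and $f\circ\rho_1(x)=\rho_2(\alpha(x))\circ f$ for all $x\in L$ (note the twist by $\alpha$). *)

theory Defs
  imports "HOL-Computational_Algebra.Computational_Algebra"
begin

text \<open>
  A vector space is a type together with a scalar multiplication satisfying the library locale
  \<^locale>\<open>vector_space\<close>. The definitions do not restrict the characteristic of the base
  field; where it matters, it is a separate hypothesis.
\<close>

locale hom_lie_algebra = vector_space scale
  for scale :: "'f::field \<Rightarrow> 'l::ab_group_add \<Rightarrow> 'l" +
  fixes bracket :: "'l \<Rightarrow> 'l \<Rightarrow> 'l"
    and alpha :: "'l \<Rightarrow> 'l"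
  assumes bracket_linear_left: "Vector_Spaces.linear scale scale (\<lambda>x. bracket x y)"
    and bracket_linear_right: "Vector_Spaces.linear scale scale (bracket x)"
    and alpha_linear: "Vector_Spaces.linear scale scale alpha"
    and bracket_skew: "bracket x y = - bracket y x"
    and hom_jacobi:
      "bracket (alpha x) (bracket y z) + bracket (alpha y) (bracket z x)
        + bracket (alpha z) (bracket x y) = 0"
    and alpha_bracket: "alpha (bracket x y) = bracket (alpha x) (alpha y)"
begin

definition is_ideal :: "'l set \<Rightarrow> bool" where
  "is_ideal I \<longleftrightarrow> subspace I \<and> (\<forall>x\<in>I. \<forall>y. bracket x y \<in> I) \<and> alpha ` I \<subseteq> I"

definition abelian :: bool where
  "abelian \<longleftrightarrow> (\<forall>x y. bracket x y = 0)"

end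

locale simple_hom_lie_algebra = hom_lie_algebra +
  assumes not_abelian: "\<not> abelian"
    and ideals_trivial: "is_ideal I \<Longrightarrow> I = {0} \<or> I = UNIV"

locale hom_lie_module =
  hom_lie_algebra scaleL bracket alpha + V: vector_space scaleV
  for scaleL :: "'f::field \<Rightarrow> 'l::ab_group_add \<Rightarrow> 'l"
    and bracket :: "'l \<Rightarrow> 'l \<Rightarrow> 'l"
    and alpha :: "'l \<Rightarrow> 'l"
    and scaleV :: "'f \<Rightarrow> 'v::ab_group_add \<Rightarrow> 'v" +
  fixes rho :: "'l \<Rightarrow> 'v \<Rightarrow> 'v"
    and beta :: "'v \<Rightarrow> 'v"
  assumes rho_endo: "Vector_Spaces.linear scaleV scaleV (rho x)"
    and rho_linear: "Vector_Spaces.linear scaleL scaleV (\<lambda>x. rho x v)"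
      \<comment> \<open>together with \<open>rho_endo\<close>: \<open>rho\<close> is a linear map from \<open>L\<close> into \<open>End(V)\<close>, whose
          vector space structure is pointwise\<close>
    and beta_linear: "Vector_Spaces.linear scaleV scaleV beta"
    and beta_rho: "beta \<circ> rho x = rho (alpha x) \<circ> beta"
    and rho_bracket:
      "rho (bracket x y) (beta v) = rho (alpha x) (rho y v) - rho (alpha y) (rho x v)"

locale hom_lie_module_hom =
  dom: hom_lie_module scaleL bracket alpha scale1 rho1 beta1 +
  cod: hom_lie_module scaleL bracket alpha scale2 rho2 beta2 +
  Vector_Spaces.linear scale1 scale2 f
  for scaleL :: "'f::field \<Rightarrow> 'l::ab_group_add \<Rightarrow> 'l"
    and bracket :: "'l \<Rightarrow> 'l \<Rightarrow> 'l"
    and alpha :: "'l \<Rightarrow> 'l"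
    and scale1 :: "'f \<Rightarrow> 'v::ab_group_add \<Rightarrow> 'v"
    and rho1 :: "'l \<Rightarrow> 'v \<Rightarrow> 'v"
    and beta1 :: "'v \<Rightarrow> 'v"
    and scale2 :: "'f \<Rightarrow> 'w::ab_group_add \<Rightarrow> 'w"
    and rho2 :: "'l \<Rightarrow> 'w \<Rightarrow> 'w"
    and beta2 :: "'w \<Rightarrow> 'w"
    and f :: "'v \<Rightarrow> 'w" +
  assumes hom_beta: "beta2 \<circ> f = f \<circ> beta1"
    and hom_rho: "f \<circ> rho1 x = rho2 (alpha x) \<circ> f"

text \<open>Integer powers of a map; the negative ones are meaningful for bijections only.\<close>

definition int_pow_map :: "('a \<Rightarrow> 'a) \<Rightarrow> int \<Rightarrow> 'a \<Rightarrow> 'a" where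
  "int_pow_map g k = (if k \<ge> 0 then g ^^ nat k else inv g ^^ nat (- k))"

definition ad :: "('l \<Rightarrow> 'l \<Rightarrow> 'l) \<Rightarrow> ('l \<Rightarrow> 'l) \<Rightarrow> int \<Rightarrow> 'l \<Rightarrow> 'l \<Rightarrow> 'l" where
  "ad bracket alpha k x y = bracket (int_pow_map alpha k x) y"

text \<open>
  \<^locale>\<open>hom_lie_module_hom\<close> requires domain and codomain to be modules. For the adjoint modules
  this is automatic: with \<open>alpha\<close> invertible, \<open>ad\<close> is a module structure for every integer \<open>k\<close>.
\<close>

context hom_lie_algebra
begin

lemma inv_alpha_linear:
  assumes "bij alpha"
  shows "Vector_Spaces.linear scale scale (inv alpha)"
proof -
  interpret A: Vector_Spaces.linear scale scale alpha by (rule alpha_linear)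
  show ?thesis
  proof (unfold_locales)
    fix x y c
    show "inv alpha (x + y) = inv alpha x + inv alpha y"
      by (metis A.add assms bij_inv_eq_iff)
    show "inv alpha (scale c x) = scale c (inv alpha x)"
      by (metis A.scale assms bij_inv_eq_iff)
  qed
qed

lemma inv_alpha_bracket:
  assumes "bij alpha"
  shows "inv alpha (bracket x y) = bracket (inv alpha x) (inv alpha y)"
  by (metis alpha_bracket assms bij_inv_eq_iff)

lemma funpow_linear:
  assumes "Vector_Spaces.linear scale scale g"
  shows "Vector_Spaces.linear scale scale (g ^^ n)"
proof (induction n)
  case 0
  show ?case using linear_id by (simp add: id_def)
next
  case (Suc n)
  then show ?case using Vector_Spaces.linear_compose[OF Suc assms] by (simp add: comp_def)
qed

lemma int_pow_map_linear:
  assumes "bij alpha"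
  shows "Vector_Spaces.linear scale scale (int_pow_map alpha k)"
  using funpow_linear[OF alpha_linear] funpow_linear[OF inv_alpha_linear[OF assms]]
  by (simp add: int_pow_map_def)

lemma funpow_bracket:
  assumes "\<And>x y. g (bracket x y) = bracket (g x) (g y)"
  shows "(g ^^ n) (bracket x y) = bracket ((g ^^ n) x) ((g ^^ n) y)"
  by (induction n) (simp_all add: assms)

lemma int_pow_map_bracket:
  assumes "bij alpha"
  shows "int_pow_map alpha k (bracket x y)
    = bracket (int_pow_map alpha k x) (int_pow_map alpha k y)"
  using funpow_bracket[of alpha, OF alpha_bracket]
    funpow_bracket[of "inv alpha", OF inv_alpha_bracket[OF assms]]
  by (simp add: int_pow_map_def)

lemma int_pow_map_alpha:
  assumes "bij alpha"
  shows "int_pow_map alpha k (alpha x) = alpha (int_pow_map alpha k x)"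
proof -
  have "(inv alpha ^^ n) (alpha x) = alpha ((inv alpha ^^ n) x)" for n
    by (induction n) (simp_all add: assms bij_is_inj bij_is_surj surj_f_inv_f)
  then show ?thesis by (simp add: int_pow_map_def funpow_swap1)
qed

lemma ad_module:
  assumes "bij alpha"
  shows "hom_lie_module scale bracket alpha scale (ad bracket alpha k) alpha"
proof -
  let ?p = "int_pow_map alpha k"
  interpret A: Vector_Spaces.linear scale scale alpha by (rule alpha_linear)
  interpret P: Vector_Spaces.linear scale scale ?p by (rule int_pow_map_linear[OF assms])
  interpret R: Vector_Spaces.linear scale scale "bracket x" for x by (rule bracket_linear_right)
  interpret Q: Vector_Spaces.linear scale scale "\<lambda>x. bracket x y" for y
    by (rule bracket_linear_left)
  have rep: "ad bracket alpha k (bracket x y) (alpha v) =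
      ad bracket alpha k (alpha x) (ad bracket alpha k y v)
      - ad bracket alpha k (alpha y) (ad bracket alpha k x v)" for x y v
  proof -
    let ?a = "?p x" and ?b = "?p y"
    have "bracket (alpha v) (bracket ?a ?b) = - bracket (bracket ?a ?b) (alpha v)"
      by (rule bracket_skew)
    moreover have "bracket (alpha ?b) (bracket v ?a) = - bracket (alpha ?b) (bracket ?a v)"
      by (metis R.neg bracket_skew)
    ultimately have "bracket (alpha ?a) (bracket ?b v) - bracket (alpha ?b) (bracket ?a v)
        - bracket (bracket ?a ?b) (alpha v) = 0"
      using hom_jacobi[of ?a ?b v] by simp
    then show ?thesis
      by (simp add: ad_def int_pow_map_bracket[OF assms] int_pow_map_alpha[OF assms])
  qed
  show ?thesis
    by unfold_locales
      (simp_all add: ad_def[abs_def] P.add P.scale A.add A.scale R.add R.scale Q.add Q.scale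
        fun_eq_iff alpha_bracket int_pow_map_alpha[OF assms] rep[unfolded ad_def[abs_def]])
qed

end

end

theory Submission
  imports Defs
begin

text \<open>
  Put \<open>A = \<alpha>\<^bsup>s+1\<^esup>\<close>. The twist in the definition of a homomorphism says
  \<open>f [\<alpha>\<^sup>k u, y] = [\<alpha>\<^bsup>k+s+1\<^esup> u, f y]\<close>, that is, \<open>f [u, y] = [A u, f y]\<close> for all \<open>u\<close> and \<open>y\<close>,
  because \<open>\<alpha>\<^sup>k\<close> is surjective. Since \<open>A\<close> preserves the bracket, \<open>A\<close> itself satisfies the same
  identity, and so does every multiple \<open>c A\<close>. The set where \<open>f\<close> and \<open>c A\<close> agree is therefore
  closed under brackets with arbitrary elements; it is stable under \<open>\<alpha>\<close>, as \<open>f\<close> and \<open>A\<close> commute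
  with \<open>\<alpha>\<close>. Hence it is an ideal (\<open>hom_lie_algebra.agreement_is_ideal\<close>). This is Schur's lemma:
  for \<open>c\<close> an eigenvalue of \<open>A\<^sup>-\<^sup>1 f\<close> the ideal is nonzero, so by simplicity it is everything.

  The eigenvalue is the only place where finite dimension and algebraic closure enter
  (\<open>linear_has_eigenvector\<close>). Among all pairs of a nonzero polynomial \<open>p\<close> and a nonzero vector
  \<open>v\<close> with \<open>p(T) v = 0\<close>, one with \<open>p\<close> of least degree has a factorization \<open>p = (X - c) q\<close>, and
  \<open>q(T) v\<close> is an eigenvector. Such pairs exist because the vectors \<open>T\<^sup>i v\<close> cannot all be
  independent.
\<close>

section \<open>Polynomials in a linear map\<close>

text \<open>
  The vector \<open>p(g) v\<close>, by Horner's scheme. Keeping \<open>v\<close> an argument, rather than forming the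
  endomorphism \<open>p(g)\<close>, lets the equations below be proved along the coefficients of \<open>p\<close>.
\<close>

definition poly_act ::
  "('f::field \<Rightarrow> 'l::ab_group_add \<Rightarrow> 'l) \<Rightarrow> ('l \<Rightarrow> 'l) \<Rightarrow> 'f poly \<Rightarrow> 'l \<Rightarrow> 'l" where
  "poly_act scale g p v = fold_coeffs (\<lambda>a w. scale a v + g w) p 0"

context vector_space
begin

lemma poly_act_0 [simp]: "poly_act scale g 0 v = 0"
  by (simp add: poly_act_def)

context
  fixes g :: "'b \<Rightarrow> 'b"
  assumes g: "Vector_Spaces.linear scale scale g"
begin

interpretation g: Vector_Spaces.linear scale scale g
  by (rule g)

lemma poly_act_pCons [simp]:
  "poly_act scale g (pCons a p) v = scale a v + g (poly_act scale g p v)"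
  by (cases "p = 0"; cases "a = 0") (simp_all add: poly_act_def g.zero)

lemma poly_act_add:
  "poly_act scale g (p + q) v = poly_act scale g p v + poly_act scale g q v"
  by (induction p q rule: poly_induct2) (simp_all add: g.add scale_left_distrib algebra_simps)

lemma poly_act_smult: "poly_act scale g (smult c p) v = scale c (poly_act scale g p v)"
  by (induction p) (simp_all add: g.scale scale_right_distrib)

lemma poly_act_monom: "poly_act scale g (monom 1 n) v = (g ^^ n) v"
  by (induction n) (simp_all add: monom_0 monom_Suc g.zero)

lemma poly_act_linear_factor:
  "poly_act scale g ([:- c, 1:] * q) v
    = g (poly_act scale g q v) - scale c (poly_act scale g q v)"
proof -
  have "[:- c, 1:] * q = pCons 0 q + smult (- c) q"
    by simp
  then show ?thesis
    by (simp only: poly_act_add poly_act_smult poly_act_pCons) simp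
qed

text \<open>
  The degree bound, written as the vanishing of high coefficients so that the zero polynomial is
  covered, is what makes the difference of \<open>monom 1 n\<close> and \<open>q\<close> nonzero below.
\<close>

lemma span_orbit_poly_act:
  assumes "x \<in> span ((\<lambda>i. (g ^^ i) v) ` {..<n})"
  obtains q where "\<forall>i\<ge>n. coeff q i = 0" "x = poly_act scale g q v"
proof -
  let ?Q = "{poly_act scale g q v | q. \<forall>i\<ge>n. coeff q i = 0}"
  have "subspace ?Q"
  proof (rule subspaceI)
    show "0 \<in> ?Q"
      by (auto intro!: exI[of _ 0])
  next
    fix x y assume "x \<in> ?Q" "y \<in> ?Q"
    then obtain p q where "\<forall>i\<ge>n. coeff p i = 0" "x = poly_act scale g p v"
      "\<forall>i\<ge>n. coeff q i = 0" "y = poly_act scale g q v" by blast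
    then show "x + y \<in> ?Q"
      by (auto intro!: exI[of _ "p + q"] simp: poly_act_add)
  next
    fix c x assume "x \<in> ?Q"
    then obtain p where "\<forall>i\<ge>n. coeff p i = 0" "x = poly_act scale g p v" by blast
    then show "scale c x \<in> ?Q"
      by (auto intro!: exI[of _ "smult c p"] simp: poly_act_smult)
  qed
  moreover have "(g ^^ i) v \<in> ?Q" if "i < n" for i
    using that by (auto intro!: exI[of _ "monom 1 i"] simp: poly_act_monom)
  ultimately have "x \<in> ?Q"
    using span_minimal[of "(\<lambda>i. (g ^^ i) v) ` {..<n}" ?Q] assms by blast
  then show thesis
    using that by blast
qed

end

end

section \<open>Eigenvectors over an algebraically closed field\<close>

text \<open>
  If \<open>v\<close> had no annihilating polynomial, no \<open>g\<^sup>n v\<close> would be a combination of the earlier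
  ones, and the orbit of \<open>v\<close> would contain independent sets of every finite size.
\<close>

lemma (in finite_dimensional_vector_space) annihilating_poly_exists:
  assumes g: "Vector_Spaces.linear scale scale g"
  shows "\<exists>p. p \<noteq> 0 \<and> poly_act scale g p v = 0"
proof (rule ccontr)
  assume none: "\<not> ?thesis"
  let ?S = "\<lambda>n. (\<lambda>i. (g ^^ i) v) ` {..<n}"
  have new: "(g ^^ n) v \<notin> span (?S n)" for n
  proof
    assume "(g ^^ n) v \<in> span (?S n)"
    then obtain q where q: "\<forall>i\<ge>n. coeff q i = 0" "(g ^^ n) v = poly_act scale g q v"
      by (rule span_orbit_poly_act[OF g])
    have "poly_act scale g (monom 1 n + smult (- 1) q) v = 0"
      by (simp only: poly_act_add[OF g] poly_act_smult[OF g] poly_act_monom[OF g] flip: q(2))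
        (simp add: scale_minus_left)
    moreover have "coeff (monom 1 n + smult (- 1) q) n \<noteq> 0"
      using q(1) by simp
    then have "monom 1 n + smult (- 1) q \<noteq> 0"
      by (metis coeff_0)
    ultimately show False
      using none by blast
  qed
  have "independent (?S n) \<and> card (?S n) = n" for n
  proof (induction n)
    case 0
    show ?case by (simp add: independent_empty)
  next
    case (Suc n)
    then show ?case
      using new[of n] span_base[of _ "?S n"]
      by (auto simp: lessThan_Suc card_insert_if independent_insert)
  qed
  then show False
    by (metis independent_card_le_dim dim_subset_UNIV subset_UNIV order_trans not_less_eq_eq
        order_refl)
qed

lemma linear_has_eigenvector:
  fixes scale :: "'f::alg_closed_field \<Rightarrow> 'l::ab_group_add \<Rightarrow> 'l" and v :: 'l
  assumes fin: "finite_dimensional_vector_space scale B"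
    and g: "Vector_Spaces.linear scale scale g"
    and v: "v \<noteq> 0"
  shows "\<exists>c w. w \<noteq> 0 \<and> g w = scale c w"
proof -
  interpret finite_dimensional_vector_space scale B by (rule fin)
  have "\<exists>c w. w \<noteq> 0 \<and> g w = scale c w" if "p \<noteq> 0" "v \<noteq> 0" "poly_act scale g p v = 0" for p v
    using that
  proof (induction "degree p" arbitrary: p v rule: less_induct)
    case less
    interpret g: Vector_Spaces.linear scale scale g by (rule g)
    have "degree p > 0"
    proof (rule ccontr)
      assume "\<not> degree p > 0"
      then obtain a where "p = [:a:]"
        using degree_eq_zeroE by blast
      with less.prems show False
        by (simp add: poly_act_pCons[OF g] g.zero)
    qed
    then obtain c where "poly p c = 0"
      using alg_closed_imp_poly_has_root by blast
    then obtain q where pq: "p = [:- c, 1:] * q"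
      by (auto simp: poly_eq_0_iff_dvd elim: dvdE)
    with less.prems have "q \<noteq> 0" by auto
    then have "degree q < degree p"
      unfolding pq by (subst degree_mult_eq) auto
    show ?case
    proof (cases "poly_act scale g q v = 0")
      case True
      then show ?thesis
        using less.hyps[OF \<open>degree q < degree p\<close> \<open>q \<noteq> 0\<close> less.prems(2)] by blast
    next
      case False
      with less.prems(3) show ?thesis
        unfolding pq poly_act_linear_factor[OF g] by auto
    qed
  qed
  then show ?thesis
    using annihilating_poly_exists[OF g, of v] v by blast
qed

section \<open>Integer powers of a bijection\<close>

lemma int_pow_map_0 [simp]: "int_pow_map g 0 x = x"
  by (simp add: int_pow_map_def)

lemma int_pow_map_plus_1:
  assumes "bij g"
  shows "int_pow_map g (k + 1) x = g (int_pow_map g k x)"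
proof (cases "k \<ge> 0")
  case True
  then show ?thesis
    by (simp add: int_pow_map_def nat_add_distrib)
next
  case False
  then obtain n where "k = - int (Suc n)"
    using negD by fastforce
  then show ?thesis
    using assms by (cases n) (simp_all add: int_pow_map_def nat_add_distrib bij_is_surj surj_f_inv_f)
qed

lemma int_pow_map_add:
  assumes "bij g"
  shows "int_pow_map g (k + m) x = int_pow_map g k (int_pow_map g m x)"
proof (induction k rule: int_induct[where k = 0])
  case base
  show ?case by simp
next
  case (step1 i)
  then show ?case
    using int_pow_map_plus_1[OF assms, of "i + m"] int_pow_map_plus_1[OF assms, of i]
    by (simp add: algebra_simps)
next
  case (step2 i)
  have "g (int_pow_map g (i - 1 + m) x) = g (int_pow_map g (i - 1) (int_pow_map g m x))"
    using step2 int_pow_map_plus_1[OF assms, of "i - 1 + m" x]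
      int_pow_map_plus_1[OF assms, of "i - 1" "int_pow_map g m x"]
    by (simp add: algebra_simps)
  then show ?case
    using assms by (meson bij_is_inj injD)
qed

section \<open>Schur's lemma\<close>

text \<open>
  The commutation with \<open>alpha\<close> and the twisted bracket identity of \<open>f\<close> also hold for
  every \<open>scale c \<circ> A\<close>, and the set of arguments where two linear maps with these properties
  agree inherits closure under \<open>bracket u\<close> and \<open>alpha\<close>. Skew-symmetry turns
  the left ideal so obtained into an ideal.
\<close>

lemma (in hom_lie_algebra) agreement_is_ideal:
  assumes f: "Vector_Spaces.linear scale scale f"
    and A: "Vector_Spaces.linear scale scale A"
    and f_alpha: "\<And>x. f (alpha x) = alpha (f x)"
    and A_alpha: "\<And>x. A (alpha x) = alpha (A x)"
    and f_bracket: "\<And>u y. f (bracket u y) = bracket (A u) (f y)"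
    and A_bracket: "\<And>u y. A (bracket u y) = bracket (A u) (A y)"
  shows "is_ideal {x. f x = scale c (A x)}"
proof -
  interpret f: Vector_Spaces.linear scale scale f by (rule f)
  interpret A: Vector_Spaces.linear scale scale A by (rule A)
  interpret alpha: Vector_Spaces.linear scale scale alpha by (rule alpha_linear)
  interpret R: Vector_Spaces.linear scale scale "bracket x" for x by (rule bracket_linear_right)
  let ?K = "{x. f x = scale c (A x)}"
  have "subspace ?K"
    by (rule subspaceI)
      (simp_all add: f.zero A.zero f.add A.add f.scale A.scale scale_right_distrib mult.commute)
  moreover have "bracket x u \<in> ?K" if "x \<in> ?K" for x u
  proof -
    have "bracket u x \<in> ?K"
      using that by (simp add: f_bracket A_bracket R.scale)
    then show ?thesis
      using subspace_neg[OF \<open>subspace ?K\<close>] bracket_skew[of x u] by metis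
  qed
  moreover have "alpha ` ?K \<subseteq> ?K"
    by (auto simp: f_alpha A_alpha alpha.scale)
  ultimately show ?thesis
    unfolding is_ideal_def by blast
qed

theorem theorem2p8:
  fixes scale :: "'f::alg_closed_field \<Rightarrow> 'l::ab_group_add \<Rightarrow> 'l"
    and bracket :: "'l \<Rightarrow> 'l \<Rightarrow> 'l"
    and alpha f :: "'l \<Rightarrow> 'l"
    and k s :: int
  assumes "CHAR('f) \<noteq> 2"
    and "simple_hom_lie_algebra scale bracket alpha"
    and "bij alpha"
    and "\<exists>B. finite_dimensional_vector_space scale B"
    and "hom_lie_module_hom scale bracket alpha
           scale (ad bracket alpha k) alpha
           scale (ad bracket alpha (k + s)) alpha f"
  shows "\<exists>c. f = (\<lambda>x. scale c (int_pow_map alpha (s + 1) x))"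
proof -
  interpret simple_hom_lie_algebra scale bracket alpha by (rule assms(2))
  interpret f: hom_lie_module_hom scale bracket alpha scale "ad bracket alpha k" alpha
    scale "ad bracket alpha (k + s)" alpha f by (rule assms(5))
  obtain B where B: "finite_dimensional_vector_space scale B"
    using assms(4) by blast
  define A where "A = int_pow_map alpha (s + 1)"
  define T where "T = int_pow_map alpha (- (s + 1)) \<circ> f"
  have f_linear: "Vector_Spaces.linear scale scale f"
    by unfold_locales
  have A_linear: "Vector_Spaces.linear scale scale A"
    unfolding A_def by (rule int_pow_map_linear[OF assms(3)])
  have T_linear: "Vector_Spaces.linear scale scale T"
    unfolding T_def
    by (rule Vector_Spaces.linear_compose[OF f_linear int_pow_map_linear[OF assms(3)]])
  have A_T: "A (T x) = f x" for x
    unfolding A_def T_def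
    using int_pow_map_add[OF assms(3), of "s + 1" "- (s + 1)"] by simp
  have f_alpha: "f (alpha x) = alpha (f x)" for x
    using f.hom_beta by (metis comp_apply)
  have f_bracket: "f (bracket u y) = bracket (A u) (f y)" for u y
  proof -
    \<comment> \<open>The module homomorphism law speaks of \<open>[alpha\<^sup>k x, y]\<close>, so it is used at the
        preimage of \<open>u\<close> under \<open>alpha\<^sup>k\<close>.\<close>
    let ?x = "int_pow_map alpha (- k) u"
    have "int_pow_map alpha k ?x = u"
      using int_pow_map_add[OF assms(3), of k "- k" u] by simp
    moreover have "int_pow_map alpha (k + s) (alpha ?x) = A u"
      using int_pow_map_add[OF assms(3), of "k + s" "- k" u]
        int_pow_map_plus_1[OF assms(3), of s u]
      by (simp add: int_pow_map_alpha[OF assms(3)] A_def)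
    moreover have "f (ad bracket alpha k ?x y) = ad bracket alpha (k + s) (alpha ?x) (f y)"
      using f.hom_rho by (metis comp_apply)
    ultimately show ?thesis
      by (simp add: ad_def)
  qed
  have ideal: "is_ideal {x. f x = scale c (A x)}" for c
    by (rule agreement_is_ideal[OF f_linear A_linear f_alpha _ f_bracket])
      (simp_all add: A_def int_pow_map_alpha[OF assms(3)] int_pow_map_bracket[OF assms(3)])
  obtain v :: 'l where "v \<noteq> 0"
    using not_abelian unfolding abelian_def by blast
  then obtain c w where w: "w \<noteq> 0" "T w = scale c w"
    using linear_has_eigenvector[OF B T_linear] by blast
  interpret A: Vector_Spaces.linear scale scale A by (rule A_linear)
  have "f w = scale c (A w)"
    using A_T[of w] w(2) by (simp add: A.scale)
  with w(1) have "{x. f x = scale c (A x)} \<noteq> {0}"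
    by blast
  then have "{x. f x = scale c (A x)} = UNIV"
    using ideals_trivial[OF ideal] by blast
  then show ?thesis
    unfolding A_def by blast
qed

end
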